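(* Let $\mathcal{A},\mathcal{B}\in\mathbb{C}^{\mathbf{N}(n)\times\mathbf{N}(n)}$ be core tensors. If $(\mathcal{A}*_n\mathcal{B})^{\mathrm{core}}=\mathcal{B}^{\mathrm{core}}*_n\mathcal{A}^{\mathrm{core}}$, then: (a) $\mathscr{R}(\mathcal{A}*_n\mathcal{B})\subseteq\mathscr{R}(\mathcal{B}*_n\mathcal{A})$; (b) $\mathcal{B}*_n\mathcal{B}^{\mathrm{core}}*_n\mathcal{A}^{\mathrm{core}}\in\mathcal{C}\{3,6\}$, where $\mathcal{C}=\mathcal{A}*_n\mathcal{B}*_n\mathcal{B}^{\mathrm{core}}$.
   Context: Here $\mathbf{N}(n)=N_1\times\cdots\times N_n$ and $\mathbb{C}^{\mathbf{N}(n)\times\mathbf{N}(n)}$ is the set of complex tensors $\mathcal{A}=(a_{i_1\ldots i_n j_1\ldots j_n})$ with $1\le i_k,j_k\le N_k$. The Einstein product is $(\mathcal{A}*_n\mathcal{B})_{i_1\ldots i_n j_1\ldots j_n}=\sum_{k_1,\ldots,k_n}a_{i_1\ldots i_n k_1\ldots k_n}b_{k_1\ldots k_n j_1\ldots j_n}$ (and similarly $\mathcal{A}*_n\mathcal{X}\in\mathbb{C}^{\mathbf{N}(n)}$ for $\mathcal{X}\in\mathbb{C}^{\mathbf{N}(n)}$), powers are taken with respect to $*_n$, and $\mathcal{A}^*$ is the conjugate transpose (swap the first $n$ and last $n$ indices and conjugate). The range is $\mathscr{R}(\mathcal{A})=\{\mathcal{A}*_n\mathcal{X}:\mathcal{X}\in\mathbb{C}^{\mathbf{N}(n)}\}$.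 The index $\mathrm{ind}(\mathcal{A})$ is the smallest positive integer $k$ with $\mathscr{R}(\mathcal{A}^k)=\mathscr{R}(\mathcal{A}^{k+1})$; $\mathcal{A}$ is a core tensor if $\mathrm{ind}(\mathcal{A})=1$. The core inverse $\mathcal{A}^{\mathrm{core}}$ is the tensor $\mathcal{X}$ (unique when it exists; it exists when $\mathcal{A}$ is a core tensor) with $(\mathcal{A}*_n\mathcal{X})^*=\mathcal{A}*_n\mathcal{X}$, $\mathcal{X}*_n\mathcal{A}^2=\mathcal{A}$, $\mathcal{A}*_n\mathcal{X}^2=\mathcal{X}$. An equality involving a core inverse is understood to include its existence. $\mathcal{C}\{3,6\}$ is the set of tensors $\mathcal{X}$ with (3) $(\mathcal{C}*_n\mathcal{X})^*=\mathcal{C}*_n\mathcal{X}$ and (6) $\mathcal{X}*_n\mathcal{C}^2=\mathcal{C}$. *)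

theory Defs
  imports Complex_Main
begin

text \<open>
  A list \<open>N = [N\<^sub>1, \<dots>, N\<^sub>n]\<close> of positive integers gives the dimensions, so \<open>n = length N\<close>.
  Multi-indices are 1-based.  The last \<open>n\<close> indices of a tensor of order \<open>2n\<close> are kept
  in a separate argument.
\<close>

definition multi_index :: "nat list \<Rightarrow> nat list set" where
  "multi_index N = {is. list_all2 (\<lambda>i m. 1 \<le> i \<and> i \<le> m) is N}"

type_synonym vtensor = "nat list \<Rightarrow> complex"
type_synonym tensor = "nat list \<Rightarrow> nat list \<Rightarrow> complex"

text \<open>
  Entries outside the index range are required to be zero, so that equality of functions is
  equality of tensors.
\<close>

definition vtensors :: "nat list \<Rightarrow> vtensor set" where
  "vtensors N = {x. \<forall>i. i \<notin> multi_index N \<longrightarrow> x i = 0}"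

definition tensors :: "nat list \<Rightarrow> tensor set" where
  "tensors N = {A. \<forall>i j. i \<notin> multi_index N \<or> j \<notin> multi_index N \<longrightarrow> A i j = 0}"

definition einstein :: "tensor \<Rightarrow> nat list \<Rightarrow> tensor \<Rightarrow> tensor"
    (\<open>_ \<star>\<^bsub>_\<^esub> _\<close> [70, 0, 71] 70) where
  "A \<star>\<^bsub>N\<^esub> B = (\<lambda>i j. \<Sum>k\<in>multi_index N. A i k * B k j)"

definition einstein_vec :: "nat list \<Rightarrow> tensor \<Rightarrow> vtensor \<Rightarrow> vtensor" where
  "einstein_vec N A x = (\<lambda>i. \<Sum>k\<in>multi_index N. A i k * x k)"

definition id_tensor :: "nat list \<Rightarrow> tensor" where
  "id_tensor N = (\<lambda>i j. if i \<in> multi_index N \<and> i = j then 1 else 0)"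

primrec tensor_pow :: "nat list \<Rightarrow> tensor \<Rightarrow> nat \<Rightarrow> tensor" where
  "tensor_pow N A 0 = id_tensor N"
| "tensor_pow N A (Suc k) = tensor_pow N A k \<star>\<^bsub>N\<^esub> A"

definition conj_transpose :: "tensor \<Rightarrow> tensor" where
  "conj_transpose A = (\<lambda>i j. cnj (A j i))"

definition tensor_range :: "nat list \<Rightarrow> tensor \<Rightarrow> vtensor set" where
  "tensor_range N A = einstein_vec N A ` vtensors N"

definition tensor_index :: "nat list \<Rightarrow> tensor \<Rightarrow> nat" where
  "tensor_index N A =
    (LEAST k. 0 < k \<and> tensor_range N (tensor_pow N A k) = tensor_range N (tensor_pow N A (k + 1)))"

definition core_tensor :: "nat list \<Rightarrow> tensor \<Rightarrow> bool" where
  "core_tensor N A \<longleftrightarrow> A \<in> tensors N \<and> tensor_index N A = 1"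

definition is_core_inverse :: "nat list \<Rightarrow> tensor \<Rightarrow> tensor \<Rightarrow> bool" where
  "is_core_inverse N A X \<longleftrightarrow>
     X \<in> tensors N \<and>
     conj_transpose (A \<star>\<^bsub>N\<^esub> X) = A \<star>\<^bsub>N\<^esub> X \<and>
     X \<star>\<^bsub>N\<^esub> tensor_pow N A 2 = A \<and>
     A \<star>\<^bsub>N\<^esub> tensor_pow N X 2 = X"

definition has_core_inverse :: "nat list \<Rightarrow> tensor \<Rightarrow> bool" where
  "has_core_inverse N A \<longleftrightarrow> (\<exists>X. is_core_inverse N A X)"

text \<open>
  A core inverse is unique when it exists; the value of \<open>core_inverse N A\<close> is meaningful
  only under \<open>has_core_inverse N A\<close>, which holds for every core tensor.
\<close>

definition core_inverse :: "nat list \<Rightarrow> tensor \<Rightarrow> tensor" where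
  "core_inverse N A = (THE X. is_core_inverse N A X)"

definition inverses_3_6 :: "nat list \<Rightarrow> tensor \<Rightarrow> tensor set" where
  "inverses_3_6 N C =
     {X \<in> tensors N. conj_transpose (C \<star>\<^bsub>N\<^esub> X) = C \<star>\<^bsub>N\<^esub> X \<and>
                     X \<star>\<^bsub>N\<^esub> tensor_pow N C 2 = C}"

end

theory Submission imports Defs begin

text \<open>
  Write \<open>X\<close>, \<open>Y\<close> for the core inverses of \<open>A\<close>, \<open>B\<close>, and put \<open>M = A B\<close>, \<open>Z = Y X\<close>.
  Once \<open>X\<close>, \<open>Y\<close> and \<open>Z\<close> are known to satisfy the equations of core inverses of \<open>A\<close>, \<open>B\<close>
  and \<open>M\<close>, both claims are equational.  Since \<open>M = Z M\<^sup>2\<close> and \<open>B Y Y = Y\<close>, one has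
  \<open>B Y M = M\<close>.  Inserting \<open>A = X A\<^sup>2\<close> and then \<open>Z = M Z\<^sup>2\<close> gives
  \<open>M = B Y M = B Z A M = B A (B Z Z A M)\<close>, which is the inclusion of ranges.  For
  \<open>C = A B Y = M Y\<close> and \<open>T = B Y X\<close>, the product \<open>C T\<close> equals \<open>M Z\<close>, which is Hermitian, and
  \<open>C\<^sup>2 = A M Y\<close>, so that \<open>T C\<^sup>2 = B Y X A A B Y = B Y M Y = C\<close>.

  The remaining work is the existence and uniqueness of the core inverse of a tensor of
  index one.  The space of tensors is finite-dimensional, so the powers of \<open>A\<close> are linearly
  dependent, and hence \<open>A\<^sup>k = A\<^sup>k\<^sup>+\<^sup>1 Q\<close> for some \<open>k \<ge> 1\<close> and some polynomial \<open>Q\<close> in \<open>A\<close>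
  (\<open>tensor_pi_regular\<close>).  This has three consequences.
  First, the chain of ranges stabilises, so index one really means that \<open>A\<close> and \<open>A\<^sup>2\<close> have
  the same range, that is, \<open>A = A\<^sup>2 D\<close> for some \<open>D\<close>.
  Secondly, \<open>A = A\<^sup>2 D\<close> implies \<open>A = Q A\<^sup>2\<close>, and \<open>G = Q A D\<close> is then a group inverse of \<open>A\<close>.
  Thirdly, applied to \<open>H = A\<^sup>* A\<close>, where \<open>A\<^sup>*\<close> can be cancelled from \<open>A\<^sup>* A Z = A\<^sup>* A W\<close>,
  it yields \<open>K = Q A\<^sup>*\<close> with \<open>A K A = A\<close> and \<open>A K\<close> Hermitian.
  Finally \<open>G A K\<close> is the core inverse of \<open>A\<close>.
\<close>

section \<open>The semigroup of tensors with conjugate transposition\<close>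

lemma finite_multi_index: "finite (multi_index N)"
proof (induction N)
  case Nil
  then show ?case by (simp add: multi_index_def)
next
  case (Cons m N)
  have "multi_index (m # N) \<subseteq> (\<lambda>(i, is). i # is) ` ({1..m} \<times> multi_index N)"
    by (auto simp: multi_index_def list_all2_Cons2)
  then show ?case using Cons finite_subset by blast
qed

lemma einstein_assoc: "A \<star>\<^bsub>N\<^esub> B \<star>\<^bsub>N\<^esub> C = A \<star>\<^bsub>N\<^esub> (B \<star>\<^bsub>N\<^esub> C)"
proof (intro ext)
  fix i j
  have "(A \<star>\<^bsub>N\<^esub> B \<star>\<^bsub>N\<^esub> C) i j
      = (\<Sum>k\<in>multi_index N. \<Sum>l\<in>multi_index N. A i l * B l k * C k j)"
    by (simp add: einstein_def sum_distrib_right)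
  also have "\<dots> = (\<Sum>l\<in>multi_index N. \<Sum>k\<in>multi_index N. A i l * B l k * C k j)"
    by (rule sum.swap)
  also have "\<dots> = (A \<star>\<^bsub>N\<^esub> (B \<star>\<^bsub>N\<^esub> C)) i j"
    by (simp add: einstein_def sum_distrib_left mult.assoc)
  finally show "(A \<star>\<^bsub>N\<^esub> B \<star>\<^bsub>N\<^esub> C) i j = (A \<star>\<^bsub>N\<^esub> (B \<star>\<^bsub>N\<^esub> C)) i j" .
qed

lemma einstein_vec_einstein:
  "einstein_vec N (A \<star>\<^bsub>N\<^esub> B) x = einstein_vec N A (einstein_vec N B x)"
  \<comment> \<open>Regard \<open>x\<close> as a tensor all of whose columns are \<open>x\<close>.\<close>
  using fun_cong[OF fun_cong[OF einstein_assoc[of A N B "\<lambda>i _. x i"]]]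
  by (simp add: einstein_def einstein_vec_def fun_eq_iff)

lemma einstein_in_tensors:
  assumes "A \<in> tensors N" "B \<in> tensors N"
  shows "A \<star>\<^bsub>N\<^esub> B \<in> tensors N"
  using assms by (auto simp: tensors_def einstein_def)

lemma einstein_vec_in_vtensors: "A \<in> tensors N \<Longrightarrow> einstein_vec N A x \<in> vtensors N"
  by (simp add: tensors_def vtensors_def einstein_vec_def)

lemma id_tensor_in_tensors: "id_tensor N \<in> tensors N"
  by (auto simp: tensors_def id_tensor_def)

lemma id_tensor_einstein: "A \<in> tensors N \<Longrightarrow> id_tensor N \<star>\<^bsub>N\<^esub> A = A"
proof (intro ext)
  fix i j
  assume A: "A \<in> tensors N"
  have "(id_tensor N \<star>\<^bsub>N\<^esub> A) i j = (\<Sum>k\<in>multi_index N. if i = k then A k j else 0)"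
    unfolding einstein_def id_tensor_def by (rule sum.cong) auto
  also have "\<dots> = A i j" using A by (simp add: finite_multi_index tensors_def)
  finally show "(id_tensor N \<star>\<^bsub>N\<^esub> A) i j = A i j" .
qed

lemma einstein_id_tensor: "A \<in> tensors N \<Longrightarrow> A \<star>\<^bsub>N\<^esub> id_tensor N = A"
proof (intro ext)
  fix i j
  assume A: "A \<in> tensors N"
  have "(A \<star>\<^bsub>N\<^esub> id_tensor N) i j = (\<Sum>k\<in>multi_index N. if k = j then A i k else 0)"
    unfolding einstein_def id_tensor_def by (rule sum.cong) auto
  also have "\<dots> = A i j" using A by (simp add: finite_multi_index tensors_def)
  finally show "(A \<star>\<^bsub>N\<^esub> id_tensor N) i j = A i j" .
qed

lemma tensor_pow_in_tensors: "A \<in> tensors N \<Longrightarrow> tensor_pow N A k \<in> tensors N"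
  by (induction k) (auto simp: id_tensor_in_tensors einstein_in_tensors)

lemma tensor_pow_add:
  "A \<in> tensors N \<Longrightarrow> tensor_pow N A (k + l) = tensor_pow N A k \<star>\<^bsub>N\<^esub> tensor_pow N A l"
  by (induction l) (simp_all add: einstein_assoc einstein_id_tensor tensor_pow_in_tensors)

lemma tensor_pow_2: "A \<in> tensors N \<Longrightarrow> tensor_pow N A 2 = A \<star>\<^bsub>N\<^esub> A"
  by (simp add: numeral_2_eq_2 id_tensor_einstein)

lemma conj_transpose_einstein:
  "conj_transpose (A \<star>\<^bsub>N\<^esub> B) = conj_transpose B \<star>\<^bsub>N\<^esub> conj_transpose A"
  by (simp add: conj_transpose_def einstein_def mult.commute)

lemma conj_transpose_conj_transpose [simp]: "conj_transpose (conj_transpose A) = A"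
  by (simp add: conj_transpose_def)

lemma conj_transpose_in_tensors: "A \<in> tensors N \<Longrightarrow> conj_transpose A \<in> tensors N"
  by (auto simp: tensors_def conj_transpose_def)

text \<open>The involution is proper: a column whose squared norm vanishes is zero.\<close>

lemma conj_transpose_einstein_eq_0:
  assumes "A \<in> tensors N" "conj_transpose A \<star>\<^bsub>N\<^esub> A = (\<lambda>i j. 0)"
  shows "A = (\<lambda>i j. 0)"
proof (intro ext)
  fix i j
  have "(\<Sum>k\<in>multi_index N. cnj (A k j) * A k j) = 0"
    using fun_cong[OF fun_cong[OF assms(2)], of j j]
    by (simp add: einstein_def conj_transpose_def)
  then have "complex_of_real (\<Sum>k\<in>multi_index N. (cmod (A k j))\<^sup>2) = 0"
    unfolding of_real_sum by (simp add: complex_norm_square mult.commute del: of_real_power)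
  then have "(\<Sum>k\<in>multi_index N. (cmod (A k j))\<^sup>2) = 0"
    using of_real_eq_0_iff by blast
  then have "\<forall>k\<in>multi_index N. A k j = 0"
    by (simp add: sum_nonneg_eq_0_iff finite_multi_index)
  then show "A i j = 0" using assms(1) by (auto simp: tensors_def)
qed

lemma conj_transpose_cancel_left:
  assumes A: "A \<in> tensors N" "Z \<in> tensors N" "W \<in> tensors N"
    and eq: "conj_transpose A \<star>\<^bsub>N\<^esub> (A \<star>\<^bsub>N\<^esub> Z) = conj_transpose A \<star>\<^bsub>N\<^esub> (A \<star>\<^bsub>N\<^esub> W)"
  shows "A \<star>\<^bsub>N\<^esub> Z = A \<star>\<^bsub>N\<^esub> W"
proof -
  define V where "V = (\<lambda>i j. Z i j - W i j)"
  have dist: "S \<star>\<^bsub>N\<^esub> V = (\<lambda>i j. (S \<star>\<^bsub>N\<^esub> Z) i j - (S \<star>\<^bsub>N\<^esub> W) i j)" for S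
    by (simp add: V_def einstein_def right_diff_distrib sum_subtractf)
  have V: "V \<in> tensors N" using A by (auto simp: V_def tensors_def)
  have "conj_transpose A \<star>\<^bsub>N\<^esub> (A \<star>\<^bsub>N\<^esub> V) = (\<lambda>i j. 0)"
    using eq dist[of "conj_transpose A \<star>\<^bsub>N\<^esub> A"] by (simp add: einstein_assoc)
  then have "conj_transpose (A \<star>\<^bsub>N\<^esub> V) \<star>\<^bsub>N\<^esub> (A \<star>\<^bsub>N\<^esub> V) = (\<lambda>i j. 0)"
    unfolding conj_transpose_einstein einstein_assoc by (simp add: einstein_def)
  then have "A \<star>\<^bsub>N\<^esub> V = (\<lambda>i j. 0)"
    using conj_transpose_einstein_eq_0 einstein_in_tensors[OF A(1) V] by blast
  then show ?thesis unfolding dist by (simp add: fun_eq_iff)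
qed

section \<open>Linear dependence of the powers of a tensor\<close>

text \<open>Gaussian elimination: a homogeneous system with more unknowns than equations has a
  nontrivial solution.\<close>

lemma exists_nontrivial_linear_relation:
  fixes f :: "'b \<Rightarrow> 'a \<Rightarrow> 'k::field"
  assumes "finite S" "finite I" "card S < card I"
  shows "\<exists>c. (\<exists>i\<in>I. c i \<noteq> 0) \<and> (\<forall>s\<in>S. (\<Sum>i\<in>I. c i * f i s) = 0)"
  using assms
proof (induction S arbitrary: I f rule: finite_induct)
  case empty
  then have "I \<noteq> {}" by auto
  then show ?case by (intro exI[of _ "\<lambda>_. 1"]) auto
next
  case (insert s S)
  show ?case
  proof (cases "\<forall>i\<in>I. f i s = 0")
    case True
    have "card S < card I" using insert by simp
    from insert.IH[OF insert.prems(1) this, of f] True show ?thesis by auto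
  next
    case False
    then obtain p where p: "p \<in> I" "f p s \<noteq> 0" by auto
    define J where "J = I - {p}"
    have J: "finite J" "card S < card J" "I = insert p J" "p \<notin> J"
      using insert p by (auto simp: J_def)
    define g where "g = (\<lambda>i t. f i t - f i s / f p s * f p t)"
    from insert.IH[OF J(1,2), of g] obtain c where c: "\<exists>i\<in>J. c i \<noteq> 0"
      "\<And>t. t \<in> S \<Longrightarrow> (\<Sum>i\<in>J. c i * g i t) = 0" by blast
    \<comment> \<open>By construction \<open>g i s = 0\<close>, so the relation among the \<open>g i\<close> also holds at \<open>s\<close>.\<close>
    have c0: "(\<Sum>i\<in>J. c i * g i t) = 0" if "t \<in> insert s S" for t
      using that c(2) p by (auto simp: g_def)
    define d where "d = c(p := - (\<Sum>i\<in>J. c i * f i s) / f p s)"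
    have "(\<Sum>i\<in>I. d i * f i t) = (\<Sum>i\<in>J. c i * g i t)" for t
    proof -
      have "(\<Sum>i\<in>J. d i * f i t) = (\<Sum>i\<in>J. c i * f i t)"
        using J by (intro sum.cong) (auto simp: d_def)
      then show ?thesis
        using J by (simp add: d_def g_def right_diff_distrib sum_subtractf sum_divide_distrib
            sum_distrib_right mult.assoc)
    qed
    moreover have "\<exists>i\<in>I. d i \<noteq> 0" using c(1) J by (auto simp: d_def)
    ultimately show ?thesis using c0 by (intro exI[of _ d]) auto
  qed
qed

text \<open>The value at \<open>A\<close> of the polynomial with coefficients \<open>c\<close> and exponents in \<open>I\<close>; the
  exponent set is explicit so that the sum can be shifted by reindexing.\<close>

definition tensor_poly :: "nat list \<Rightarrow> tensor \<Rightarrow> (nat \<Rightarrow> complex) \<Rightarrow> nat set \<Rightarrow> tensor" where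
  "tensor_poly N A c I = (\<lambda>i j. \<Sum>l\<in>I. c l * tensor_pow N A l i j)"

lemma tensor_poly_in_tensors: "A \<in> tensors N \<Longrightarrow> tensor_poly N A c I \<in> tensors N"
  using tensor_pow_in_tensors[of A N] by (auto simp: tensors_def tensor_poly_def)

lemma tensor_pow_einstein_poly:
  assumes "A \<in> tensors N"
  shows "tensor_pow N A m \<star>\<^bsub>N\<^esub> tensor_poly N A c I
    = (\<lambda>i j. \<Sum>l\<in>I. c l * tensor_pow N A (m + l) i j)"
  unfolding tensor_pow_add[OF assms] tensor_poly_def einstein_def sum_distrib_left
  by (subst sum.swap) (simp add: mult.left_commute)

lemma tensor_poly_einstein_pow:
  assumes "A \<in> tensors N"
  shows "tensor_poly N A c I \<star>\<^bsub>N\<^esub> tensor_pow N A m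
    = (\<lambda>i j. \<Sum>l\<in>I. c l * tensor_pow N A (l + m) i j)"
  unfolding tensor_pow_add[OF assms] tensor_poly_def einstein_def sum_distrib_left sum_distrib_right
  by (subst sum.swap) (simp add: mult.assoc)

text \<open>Strong \<open>\<pi>\<close>-regularity: solve a linear relation between positive powers of \<open>A\<close> for the
  lowest power that occurs in it.\<close>

lemma tensor_pi_regular:
  assumes A: "A \<in> tensors N"
  obtains k Q where "Q \<in> tensors N"
    "tensor_pow N A (Suc k) = tensor_pow N A (Suc (Suc k)) \<star>\<^bsub>N\<^esub> Q"
    "\<And>m. Q \<star>\<^bsub>N\<^esub> tensor_pow N A m = tensor_pow N A m \<star>\<^bsub>N\<^esub> Q"
proof -
  define S where "S = multi_index N \<times> multi_index N"
  define I where "I = {1..Suc (card S)}"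
  have "finite S" by (simp add: S_def finite_multi_index)
  from exists_nontrivial_linear_relation[OF this, of I "\<lambda>l s. tensor_pow N A l (fst s) (snd s)"]
  obtain c where c: "\<exists>l\<in>I. c l \<noteq> 0"
    "\<And>s. s \<in> S \<Longrightarrow> (\<Sum>l\<in>I. c l * tensor_pow N A l (fst s) (snd s)) = 0"
    by (auto simp: I_def)
  have rel: "(\<Sum>l\<in>I. c l * tensor_pow N A l i j) = 0" for i j
  proof (cases "(i, j) \<in> S")
    case True
    from c(2)[OF this] show ?thesis by simp
  next
    case False
    then have "tensor_pow N A l i j = 0" for l
      using tensor_pow_in_tensors[OF A, of l] by (auto simp: tensors_def S_def)
    then show ?thesis by simp
  qed
  define p where "p = (LEAST l. l \<in> I \<and> c l \<noteq> 0)"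
  have p: "p \<in> I" "c p \<noteq> 0" using LeastI_ex[of "\<lambda>l. l \<in> I \<and> c l \<noteq> 0"] c(1)
    by (auto simp: p_def)
  have low: "c l = 0" if "l \<in> I" "l < p" for l
    using not_less_Least[of l "\<lambda>l. l \<in> I \<and> c l \<noteq> 0"] that by (auto simp: p_def)
  define k where "k = p - 1"
  have pk: "p = Suc k" using p by (auto simp: k_def I_def)
  define J where "J = {l\<in>I. p < l}"
  define L where "L = (\<lambda>l. l - Suc p) ` J"
  define Q where "Q = tensor_poly N A (\<lambda>l. - c (Suc p + l) / c p) L"
  have "tensor_pow N A p i j = (tensor_pow N A (Suc p) \<star>\<^bsub>N\<^esub> Q) i j" for i j
  proof -
    let ?t = "\<lambda>l. c l * tensor_pow N A l i j"
    have "(\<Sum>l\<in>I. ?t l) = (\<Sum>l\<in>insert p J. ?t l)"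
    proof (rule sum.mono_neutral_right)
      show "\<forall>l\<in>I - insert p J. ?t l = 0"
      proof
        fix l assume "l \<in> I - insert p J"
        then show "?t l = 0" using low[of l] by (cases l p rule: linorder_cases) (auto simp: J_def)
      qed
    qed (use p in \<open>auto simp: J_def I_def\<close>)
    also have "\<dots> = ?t p + (\<Sum>l\<in>J. ?t l)"
      by (subst sum.insert) (auto simp: J_def I_def)
    finally have "?t p = - (\<Sum>l\<in>J. ?t l)" using rel[of i j] by (simp add: eq_neg_iff_add_eq_0)
    then have "tensor_pow N A p i j = - (\<Sum>l\<in>J. ?t l) / c p"
      using p(2) by (simp add: field_simps)
    also have "\<dots> = (\<Sum>l\<in>J. - c l / c p * tensor_pow N A l i j)"
      by (simp add: sum_divide_distrib sum_negf)
    also have "\<dots> = (\<Sum>l\<in>L. - c (Suc p + l) / c p * tensor_pow N A (Suc p + l) i j)"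
      unfolding L_def by (subst sum.reindex) (auto simp: J_def inj_on_def simp del: tensor_pow.simps intro!: sum.cong)
    also have "\<dots> = (tensor_pow N A (Suc p) \<star>\<^bsub>N\<^esub> Q) i j"
      unfolding Q_def tensor_pow_einstein_poly[OF A] ..
    finally show ?thesis .
  qed
  then have "tensor_pow N A (Suc k) = tensor_pow N A (Suc (Suc k)) \<star>\<^bsub>N\<^esub> Q"
    unfolding pk by (intro ext)
  moreover have "Q \<star>\<^bsub>N\<^esub> tensor_pow N A m = tensor_pow N A m \<star>\<^bsub>N\<^esub> Q" for m
    unfolding Q_def tensor_pow_einstein_poly[OF A] tensor_poly_einstein_pow[OF A]
    by (simp add: add.commute)
  moreover have "Q \<in> tensors N" unfolding Q_def by (rule tensor_poly_in_tensors[OF A])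
  ultimately show ?thesis using that by blast
qed

section \<open>Ranges and the index\<close>

lemma tensor_range_einstein_subset:
  assumes "B \<in> tensors N"
  shows "tensor_range N (A \<star>\<^bsub>N\<^esub> B) \<subseteq> tensor_range N A"
  using einstein_vec_in_vtensors[OF assms]
  by (auto simp: tensor_range_def einstein_vec_einstein)

lemma einstein_vec_unit:
  assumes "j \<in> multi_index N"
  shows "einstein_vec N A (\<lambda>i. if i = j then 1 else 0) = (\<lambda>i. A i j)"
  using assms by (simp add: einstein_vec_def finite_multi_index if_distrib cong: if_cong)

lemma tensor_range_subset_factor:
  assumes A: "A \<in> tensors N" and sub: "tensor_range N A \<subseteq> tensor_range N B"
  obtains D where "D \<in> tensors N" "A = B \<star>\<^bsub>N\<^esub> D"
proof -
  have "\<exists>y. y \<in> vtensors N \<and> (\<lambda>i. A i j) = einstein_vec N B y" if j: "j \<in> multi_index N" for j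
  proof -
    have "(\<lambda>i. if i = j then 1 else 0) \<in> vtensors N" using j by (auto simp: vtensors_def)
    then have "(\<lambda>i. A i j) \<in> tensor_range N A"
      unfolding tensor_range_def einstein_vec_unit[OF j, symmetric] by (rule imageI)
    then show ?thesis using sub by (auto simp: tensor_range_def)
  qed
  then obtain y where y: "\<And>j. j \<in> multi_index N \<Longrightarrow> y j \<in> vtensors N"
    "\<And>j. j \<in> multi_index N \<Longrightarrow> (\<lambda>i. A i j) = einstein_vec N B (y j)"
    by metis
  define D where "D = (\<lambda>i j. if j \<in> multi_index N then y j i else 0)"
  have "D \<in> tensors N" using y(1) by (auto simp: D_def tensors_def vtensors_def)
  moreover have "A i j = (B \<star>\<^bsub>N\<^esub> D) i j" for i j
  proof (cases "j \<in> multi_index N")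
    case True
    from fun_cong[OF y(2)[OF True], of i] True show ?thesis
      by (simp add: D_def einstein_def einstein_vec_def)
  next
    case False
    then show ?thesis using A by (simp add: D_def einstein_def tensors_def)
  qed
  then have "A = B \<star>\<^bsub>N\<^esub> D" by (intro ext)
  ultimately show ?thesis using that by blast
qed

text \<open>The least number in the definition of the index is attained because the chain of ranges
  stabilises; otherwise the value of the index would carry no information.\<close>

lemma core_tensor_range:
  assumes "core_tensor N A"
  shows "tensor_range N A = tensor_range N (A \<star>\<^bsub>N\<^esub> A)"
proof -
  have A: "A \<in> tensors N" and ind: "tensor_index N A = 1"
    using assms by (auto simp: core_tensor_def)
  let ?P = "\<lambda>k. 0 < k \<and> tensor_range N (tensor_pow N A k) = tensor_range N (tensor_pow N A (k + 1))"
  obtain k Q where Q: "Q \<in> tensors N"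
    "tensor_pow N A (Suc k) = tensor_pow N A (Suc (Suc k)) \<star>\<^bsub>N\<^esub> Q"
    using tensor_pi_regular[OF A] by blast
  have "tensor_range N (tensor_pow N A (Suc k)) \<subseteq> tensor_range N (tensor_pow N A (Suc k + 1))"
    using tensor_range_einstein_subset[OF Q(1)] Q(2) by (metis Suc_eq_plus1)
  moreover have "tensor_range N (tensor_pow N A (Suc k + 1)) \<subseteq> tensor_range N (tensor_pow N A (Suc k))"
    using tensor_range_einstein_subset[OF A, of "tensor_pow N A (Suc k)"] by simp
  ultimately have "?P (Suc k)" by blast
  then have "?P (tensor_index N A)" unfolding tensor_index_def by (rule LeastI)
  then show ?thesis unfolding ind using A by (simp add: id_tensor_einstein)
qed

section \<open>Existence and uniqueness of the core inverse\<close>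

text \<open>Every tensor, of whatever index, has a \<open>{1,3}\<close>-inverse: an inner inverse \<open>K\<close> for which
  \<open>A K\<close> is the orthogonal projector onto the range of \<open>A\<close>.\<close>

lemma exists_inverse_1_3:
  assumes A: "A \<in> tensors N"
  obtains K where "K \<in> tensors N" "A \<star>\<^bsub>N\<^esub> K \<star>\<^bsub>N\<^esub> A = A"
    "conj_transpose (A \<star>\<^bsub>N\<^esub> K) = A \<star>\<^bsub>N\<^esub> K"
proof -
  let ?A' = "conj_transpose A"
  have A': "?A' \<in> tensors N" using A by (rule conj_transpose_in_tensors)
  define H where "H = ?A' \<star>\<^bsub>N\<^esub> A"
  have H: "H \<in> tensors N" unfolding H_def by (intro einstein_in_tensors A A')
  have H': "conj_transpose H = H" by (simp add: H_def conj_transpose_einstein)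
  obtain k Q where Q: "Q \<in> tensors N"
    "tensor_pow N H (Suc k) = tensor_pow N H (Suc (Suc k)) \<star>\<^bsub>N\<^esub> Q"
    "\<And>m. Q \<star>\<^bsub>N\<^esub> tensor_pow N H m = tensor_pow N H m \<star>\<^bsub>N\<^esub> Q"
    using tensor_pi_regular[OF H] by blast
  have pow_Suc: "tensor_pow N H (Suc m) = H \<star>\<^bsub>N\<^esub> tensor_pow N H m" for m
    using tensor_pow_add[OF H, of 1 m] by (simp add: id_tensor_einstein H)
  \<comment> \<open>\<open>H\<close> is Hermitian, so the exponent can be lowered to one.\<close>
  have "tensor_pow N H (Suc 0) = tensor_pow N H (Suc (Suc 0)) \<star>\<^bsub>N\<^esub> Q"
    using Q(2)
  proof (induction k)
    case (Suc m)
    have "conj_transpose H \<star>\<^bsub>N\<^esub> (H \<star>\<^bsub>N\<^esub> tensor_pow N H m)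
        = conj_transpose H \<star>\<^bsub>N\<^esub> (H \<star>\<^bsub>N\<^esub> (tensor_pow N H (Suc m) \<star>\<^bsub>N\<^esub> Q))"
      using Suc.prems unfolding H' pow_Suc einstein_assoc .
    then have "H \<star>\<^bsub>N\<^esub> tensor_pow N H m = H \<star>\<^bsub>N\<^esub> (tensor_pow N H (Suc m) \<star>\<^bsub>N\<^esub> Q)"
      by (rule conj_transpose_cancel_left[rotated 3])
        (intro H Q(1) einstein_in_tensors tensor_pow_in_tensors)+
    then have "tensor_pow N H (Suc m) = tensor_pow N H (Suc (Suc m)) \<star>\<^bsub>N\<^esub> Q"
      unfolding pow_Suc einstein_assoc .
    then show ?case by (rule Suc.IH)
  qed simp
  then have HHQ: "H \<star>\<^bsub>N\<^esub> H \<star>\<^bsub>N\<^esub> Q = H" using H by (simp add: id_tensor_einstein)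
  have QH: "Q \<star>\<^bsub>N\<^esub> H = H \<star>\<^bsub>N\<^esub> Q" using Q(3)[of "Suc 0"] H by (simp add: id_tensor_einstein)
  have "?A' \<star>\<^bsub>N\<^esub> (A \<star>\<^bsub>N\<^esub> id_tensor N) = ?A' \<star>\<^bsub>N\<^esub> (A \<star>\<^bsub>N\<^esub> (Q \<star>\<^bsub>N\<^esub> H))"
    using HHQ unfolding QH einstein_id_tensor[OF A] by (simp add: H_def einstein_assoc)
  then have "A \<star>\<^bsub>N\<^esub> id_tensor N = A \<star>\<^bsub>N\<^esub> (Q \<star>\<^bsub>N\<^esub> H)"
    by (rule conj_transpose_cancel_left[rotated 3])
      (intro A id_tensor_in_tensors einstein_in_tensors Q(1) H)+
  then have AQ: "A \<star>\<^bsub>N\<^esub> Q \<star>\<^bsub>N\<^esub> ?A' \<star>\<^bsub>N\<^esub> A = A"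
    unfolding einstein_id_tensor[OF A] by (simp add: H_def einstein_assoc)
  define K where "K = Q \<star>\<^bsub>N\<^esub> ?A'"
  have AKA: "A \<star>\<^bsub>N\<^esub> K \<star>\<^bsub>N\<^esub> A = A" using AQ by (simp add: K_def einstein_assoc)
  \<comment> \<open>The adjoint of \<open>A K A = A\<close> shows that \<open>A K\<close> equals \<open>A K (A K)\<^sup>*\<close>, which is Hermitian.\<close>
  have "A \<star>\<^bsub>N\<^esub> K = A \<star>\<^bsub>N\<^esub> Q \<star>\<^bsub>N\<^esub> conj_transpose (A \<star>\<^bsub>N\<^esub> K \<star>\<^bsub>N\<^esub> A)"
    unfolding AKA by (simp add: K_def einstein_assoc)
  also have "\<dots> = A \<star>\<^bsub>N\<^esub> K \<star>\<^bsub>N\<^esub> conj_transpose (A \<star>\<^bsub>N\<^esub> K)"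
    by (simp add: conj_transpose_einstein K_def einstein_assoc)
  finally have "A \<star>\<^bsub>N\<^esub> K = A \<star>\<^bsub>N\<^esub> K \<star>\<^bsub>N\<^esub> conj_transpose (A \<star>\<^bsub>N\<^esub> K)" .
  then have "conj_transpose (A \<star>\<^bsub>N\<^esub> K) = A \<star>\<^bsub>N\<^esub> K"
    by (metis conj_transpose_einstein conj_transpose_conj_transpose)
  moreover have "K \<in> tensors N" unfolding K_def by (intro einstein_in_tensors Q(1) A')
  ultimately show ?thesis using that AKA by blast
qed

text \<open>Of the three equations of a group inverse, \<open>G A G = G\<close> also holds for the \<open>G\<close> constructed
  here but is left out, because the construction of the core inverse only uses the other two.\<close>

lemma exists_group_inverse:
  assumes A: "A \<in> tensors N" and ran: "tensor_range N A = tensor_range N (A \<star>\<^bsub>N\<^esub> A)"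
  obtains G where "G \<in> tensors N" "A \<star>\<^bsub>N\<^esub> G = G \<star>\<^bsub>N\<^esub> A" "A \<star>\<^bsub>N\<^esub> G \<star>\<^bsub>N\<^esub> A = A"
proof -
  obtain D where D: "D \<in> tensors N" "A = A \<star>\<^bsub>N\<^esub> A \<star>\<^bsub>N\<^esub> D"
    using tensor_range_subset_factor[OF A] ran by blast
  obtain k Q where Q: "Q \<in> tensors N"
    "tensor_pow N A (Suc k) = tensor_pow N A (Suc (Suc k)) \<star>\<^bsub>N\<^esub> Q"
    "\<And>m. Q \<star>\<^bsub>N\<^esub> tensor_pow N A m = tensor_pow N A m \<star>\<^bsub>N\<^esub> Q"
    using tensor_pi_regular[OF A] by blast
  have QA: "Q \<star>\<^bsub>N\<^esub> A = A \<star>\<^bsub>N\<^esub> Q" using Q(3)[of "Suc 0"] A by (simp add: id_tensor_einstein)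
  \<comment> \<open>Iterating \<open>A = A\<^sup>2 D\<close> factors \<open>A\<close> through every power of itself.\<close>
  have "\<exists>F. A = tensor_pow N A (Suc m) \<star>\<^bsub>N\<^esub> F" for m
  proof (induction m)
    case 0
    show ?case using A by (auto simp: id_tensor_einstein einstein_id_tensor intro!: exI[of _ "id_tensor N"])
  next
    case (Suc m)
    then obtain F where F: "A = tensor_pow N A (Suc m) \<star>\<^bsub>N\<^esub> F" by blast
    have pow: "tensor_pow N A (Suc (Suc m)) = A \<star>\<^bsub>N\<^esub> tensor_pow N A (Suc m)"
      using tensor_pow_add[OF A, of "Suc 0" "Suc m"] by (simp add: id_tensor_einstein A)
    have "tensor_pow N A (Suc (Suc m)) \<star>\<^bsub>N\<^esub> (F \<star>\<^bsub>N\<^esub> D)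
        = A \<star>\<^bsub>N\<^esub> (tensor_pow N A (Suc m) \<star>\<^bsub>N\<^esub> F) \<star>\<^bsub>N\<^esub> D"
      unfolding pow by (simp only: einstein_assoc)
    also have "\<dots> = A" using F D(2) by argo
    finally show ?case by metis
  qed
  then obtain F where F: "A = tensor_pow N A (Suc k) \<star>\<^bsub>N\<^esub> F" by blast
  have "A = Q \<star>\<^bsub>N\<^esub> tensor_pow N A (Suc (Suc k)) \<star>\<^bsub>N\<^esub> F"
    using F unfolding Q(3) Q(2)[symmetric] .
  also have "tensor_pow N A (Suc (Suc k)) = A \<star>\<^bsub>N\<^esub> tensor_pow N A (Suc k)"
    using tensor_pow_add[OF A, of "Suc 0" "Suc k"] by (simp add: id_tensor_einstein A)
  also have "Q \<star>\<^bsub>N\<^esub> (A \<star>\<^bsub>N\<^esub> tensor_pow N A (Suc k)) \<star>\<^bsub>N\<^esub> F = Q \<star>\<^bsub>N\<^esub> A \<star>\<^bsub>N\<^esub> A"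
    by (simp only: einstein_assoc F[symmetric])
  finally have QAA: "A = Q \<star>\<^bsub>N\<^esub> A \<star>\<^bsub>N\<^esub> A" .
  have QAD: "Q \<star>\<^bsub>N\<^esub> A = A \<star>\<^bsub>N\<^esub> D"
    using D(2) QAA by (metis einstein_assoc)
  define G where "G = Q \<star>\<^bsub>N\<^esub> A \<star>\<^bsub>N\<^esub> D"
  have AG: "A \<star>\<^bsub>N\<^esub> G = Q \<star>\<^bsub>N\<^esub> A"
    using D(2) QAD unfolding G_def by (metis einstein_assoc)
  have GA: "G \<star>\<^bsub>N\<^esub> A = Q \<star>\<^bsub>N\<^esub> A"
    using QAA QAD unfolding G_def by (metis einstein_assoc)
  show ?thesis
  proof (rule that[of G])
    show "G \<in> tensors N" unfolding G_def by (intro einstein_in_tensors Q(1) A D(1))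
    show "A \<star>\<^bsub>N\<^esub> G = G \<star>\<^bsub>N\<^esub> A" using AG GA by simp
    show "A \<star>\<^bsub>N\<^esub> G \<star>\<^bsub>N\<^esub> A = A" using AG QAA by simp
  qed
qed

lemma core_tensor_has_core_inverse:
  assumes "core_tensor N A"
  shows "has_core_inverse N A"
proof -
  have A: "A \<in> tensors N" using assms by (simp add: core_tensor_def)
  obtain K where K: "K \<in> tensors N" "A \<star>\<^bsub>N\<^esub> K \<star>\<^bsub>N\<^esub> A = A"
    "conj_transpose (A \<star>\<^bsub>N\<^esub> K) = A \<star>\<^bsub>N\<^esub> K" using exists_inverse_1_3[OF A] by blast
  obtain G where G: "G \<in> tensors N" "A \<star>\<^bsub>N\<^esub> G = G \<star>\<^bsub>N\<^esub> A" "A \<star>\<^bsub>N\<^esub> G \<star>\<^bsub>N\<^esub> A = A"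
    using exists_group_inverse[OF A core_tensor_range[OF assms]] by blast
  define X where "X = G \<star>\<^bsub>N\<^esub> A \<star>\<^bsub>N\<^esub> K"
  have X: "X \<in> tensors N" unfolding X_def by (intro einstein_in_tensors G(1) A K(1))
  have AX: "A \<star>\<^bsub>N\<^esub> X = A \<star>\<^bsub>N\<^esub> K" using G(3) unfolding X_def by (metis einstein_assoc)
  have "X \<star>\<^bsub>N\<^esub> (A \<star>\<^bsub>N\<^esub> A) = A"
    using K(2) G(2,3) unfolding X_def by (metis einstein_assoc)
  moreover have "A \<star>\<^bsub>N\<^esub> (X \<star>\<^bsub>N\<^esub> X) = X"
  proof -
    have "A \<star>\<^bsub>N\<^esub> (X \<star>\<^bsub>N\<^esub> X) = A \<star>\<^bsub>N\<^esub> K \<star>\<^bsub>N\<^esub> (A \<star>\<^bsub>N\<^esub> G \<star>\<^bsub>N\<^esub> K)"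
      using AX G(2) by (metis X_def einstein_assoc)
    also have "\<dots> = A \<star>\<^bsub>N\<^esub> G \<star>\<^bsub>N\<^esub> K" using K(2) by (metis einstein_assoc)
    finally show ?thesis by (simp add: X_def G(2))
  qed
  ultimately have "is_core_inverse N A X"
    using K(3) X A by (simp add: is_core_inverse_def AX tensor_pow_2)
  then show ?thesis by (auto simp: has_core_inverse_def)
qed

lemma is_core_inverseD:
  assumes "A \<in> tensors N" "is_core_inverse N A X"
  shows "X \<in> tensors N" "conj_transpose (A \<star>\<^bsub>N\<^esub> X) = A \<star>\<^bsub>N\<^esub> X"
    "X \<star>\<^bsub>N\<^esub> A \<star>\<^bsub>N\<^esub> A = A" "A \<star>\<^bsub>N\<^esub> X \<star>\<^bsub>N\<^esub> X = X"
    "A \<star>\<^bsub>N\<^esub> X \<star>\<^bsub>N\<^esub> A = A" "X \<star>\<^bsub>N\<^esub> A \<star>\<^bsub>N\<^esub> X = X"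
proof -
  show X: "X \<in> tensors N" and "conj_transpose (A \<star>\<^bsub>N\<^esub> X) = A \<star>\<^bsub>N\<^esub> X"
    using assms by (auto simp: is_core_inverse_def)
  show XAA: "X \<star>\<^bsub>N\<^esub> A \<star>\<^bsub>N\<^esub> A = A" and AXX: "A \<star>\<^bsub>N\<^esub> X \<star>\<^bsub>N\<^esub> X = X"
    using assms X by (auto simp: is_core_inverse_def tensor_pow_2 einstein_assoc)
  show "A \<star>\<^bsub>N\<^esub> X \<star>\<^bsub>N\<^esub> A = A" using XAA AXX by (metis einstein_assoc)
  show "X \<star>\<^bsub>N\<^esub> A \<star>\<^bsub>N\<^esub> X = X" using XAA AXX by (metis einstein_assoc)
qed

lemma is_core_inverse_unique:
  assumes A: "A \<in> tensors N" and "is_core_inverse N A X" "is_core_inverse N A Y"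
  shows "X = Y"
proof -
  note X = is_core_inverseD[OF A assms(2)] and Y = is_core_inverseD[OF A assms(3)]
  have "A \<star>\<^bsub>N\<^esub> X = conj_transpose (A \<star>\<^bsub>N\<^esub> Y \<star>\<^bsub>N\<^esub> (A \<star>\<^bsub>N\<^esub> X))"
    using X(2) Y(5) by (metis einstein_assoc)
  also have "\<dots> = A \<star>\<^bsub>N\<^esub> X \<star>\<^bsub>N\<^esub> (A \<star>\<^bsub>N\<^esub> Y)"
    unfolding conj_transpose_einstein[of "A \<star>\<^bsub>N\<^esub> Y"] X(2) Y(2) ..
  also have "\<dots> = A \<star>\<^bsub>N\<^esub> Y" using X(5) by (metis einstein_assoc)
  finally have AX: "A \<star>\<^bsub>N\<^esub> X = A \<star>\<^bsub>N\<^esub> Y" .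
  have "X = X \<star>\<^bsub>N\<^esub> (A \<star>\<^bsub>N\<^esub> Y)" using X(6) AX by (metis einstein_assoc)
  also have "\<dots> = Y" using X(3) Y(4) by (metis einstein_assoc)
  finally show ?thesis .
qed

lemma is_core_inverse_core_inverse:
  assumes "A \<in> tensors N" "has_core_inverse N A"
  shows "is_core_inverse N A (core_inverse N A)"
proof -
  obtain X where X: "is_core_inverse N A X" using assms(2) by (auto simp: has_core_inverse_def)
  show ?thesis unfolding core_inverse_def
    using X is_core_inverse_unique[OF assms(1) _ X] by (rule theI)
qed

section \<open>The reverse order law\<close>

theorem theorem3p7:
  fixes N :: "nat list" and A B :: tensor
  assumes "N \<noteq> []" and "\<forall>m\<in>set N. 0 < m"
    and "core_tensor N A" and "core_tensor N B"
    and "has_core_inverse N (A \<star>\<^bsub>N\<^esub> B)"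
    and "core_inverse N (A \<star>\<^bsub>N\<^esub> B) = core_inverse N B \<star>\<^bsub>N\<^esub> core_inverse N A"
  shows "tensor_range N (A \<star>\<^bsub>N\<^esub> B) \<subseteq> tensor_range N (B \<star>\<^bsub>N\<^esub> A) \<and>
    B \<star>\<^bsub>N\<^esub> core_inverse N B \<star>\<^bsub>N\<^esub> core_inverse N A
      \<in> inverses_3_6 N (A \<star>\<^bsub>N\<^esub> B \<star>\<^bsub>N\<^esub> core_inverse N B)"
proof -
  define X where "X = core_inverse N A"
  define Y where "Y = core_inverse N B"
  define M where "M = A \<star>\<^bsub>N\<^esub> B"
  define Z where "Z = Y \<star>\<^bsub>N\<^esub> X"
  have A: "A \<in> tensors N" and B: "B \<in> tensors N" using assms by (auto simp: core_tensor_def)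
  have M: "M \<in> tensors N" unfolding M_def by (rule einstein_in_tensors[OF A B])
  note X = is_core_inverseD[OF A is_core_inverse_core_inverse[OF A
        core_tensor_has_core_inverse[OF assms(3)]], folded X_def]
  note Y = is_core_inverseD[OF B is_core_inverse_core_inverse[OF B
        core_tensor_has_core_inverse[OF assms(4)]], folded Y_def]
  have "is_core_inverse N M Z"
    using is_core_inverse_core_inverse[OF M[unfolded M_def] assms(5)] assms(6)
    by (simp add: M_def Z_def X_def Y_def)
  note Z = is_core_inverseD[OF M this]
  have BYM: "B \<star>\<^bsub>N\<^esub> Y \<star>\<^bsub>N\<^esub> M = M"
  proof -
    have "B \<star>\<^bsub>N\<^esub> Y \<star>\<^bsub>N\<^esub> Z = Z" using Y(4) unfolding Z_def by (metis einstein_assoc)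
    then show ?thesis using Z(3) by (metis einstein_assoc)
  qed
  have "M = B \<star>\<^bsub>N\<^esub> A \<star>\<^bsub>N\<^esub> (B \<star>\<^bsub>N\<^esub> Z \<star>\<^bsub>N\<^esub> Z \<star>\<^bsub>N\<^esub> A \<star>\<^bsub>N\<^esub> M)"
  proof -
    have "M = X \<star>\<^bsub>N\<^esub> A \<star>\<^bsub>N\<^esub> M" using X(3) unfolding M_def by (metis einstein_assoc)
    then have "M = B \<star>\<^bsub>N\<^esub> Z \<star>\<^bsub>N\<^esub> A \<star>\<^bsub>N\<^esub> M" using BYM unfolding Z_def by (metis einstein_assoc)
    also have "\<dots> = B \<star>\<^bsub>N\<^esub> (M \<star>\<^bsub>N\<^esub> Z \<star>\<^bsub>N\<^esub> Z) \<star>\<^bsub>N\<^esub> A \<star>\<^bsub>N\<^esub> M" by (simp only: Z(4))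
    finally show ?thesis by (simp only: M_def einstein_assoc)
  qed
  moreover have "B \<star>\<^bsub>N\<^esub> Z \<star>\<^bsub>N\<^esub> Z \<star>\<^bsub>N\<^esub> A \<star>\<^bsub>N\<^esub> M \<in> tensors N"
    by (intro einstein_in_tensors A B M Z(1))
  ultimately have a: "tensor_range N M \<subseteq> tensor_range N (B \<star>\<^bsub>N\<^esub> A)"
    using tensor_range_einstein_subset by metis
  define C where "C = M \<star>\<^bsub>N\<^esub> Y"
  define T where "T = B \<star>\<^bsub>N\<^esub> Y \<star>\<^bsub>N\<^esub> X"
  have C: "C \<in> tensors N" unfolding C_def by (intro einstein_in_tensors M Y(1))
  have T: "T \<in> tensors N" unfolding T_def by (intro einstein_in_tensors B Y(1) X(1))
  have CT: "C \<star>\<^bsub>N\<^esub> T = M \<star>\<^bsub>N\<^esub> Z"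
    using Y(6) unfolding C_def T_def Z_def by (metis einstein_assoc)
  have "T \<star>\<^bsub>N\<^esub> (C \<star>\<^bsub>N\<^esub> C) = C"
  proof -
    have "C \<star>\<^bsub>N\<^esub> C = A \<star>\<^bsub>N\<^esub> (B \<star>\<^bsub>N\<^esub> Y \<star>\<^bsub>N\<^esub> M) \<star>\<^bsub>N\<^esub> Y"
      by (simp only: C_def M_def einstein_assoc)
    also have "\<dots> = A \<star>\<^bsub>N\<^esub> M \<star>\<^bsub>N\<^esub> Y" by (simp only: BYM)
    finally have "T \<star>\<^bsub>N\<^esub> (C \<star>\<^bsub>N\<^esub> C) = B \<star>\<^bsub>N\<^esub> Y \<star>\<^bsub>N\<^esub> (X \<star>\<^bsub>N\<^esub> A \<star>\<^bsub>N\<^esub> A) \<star>\<^bsub>N\<^esub> B \<star>\<^bsub>N\<^esub> Y"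
      by (simp only: T_def M_def einstein_assoc)
    also have "\<dots> = B \<star>\<^bsub>N\<^esub> Y \<star>\<^bsub>N\<^esub> M \<star>\<^bsub>N\<^esub> Y" by (simp only: X(3)) (simp only: M_def einstein_assoc)
    also have "\<dots> = C" by (simp only: BYM C_def)
    finally show ?thesis .
  qed
  then have "T \<in> inverses_3_6 N C"
    using T C Z(2) by (simp add: inverses_3_6_def CT tensor_pow_2)
  with a show ?thesis by (simp add: C_def T_def M_def X_def Y_def)
qed

end
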